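(* Let $\mathbb{F}_q$ be a finite field with $q$ elements, let $p$ be a prime and $k\ge 1$ an integer, and suppose that $p^m\,\|\,\gcd(p^k,q-1)$, where $m\ge 1$. Let $\zeta_{p^m}\in\mathbb{F}_q$ be a primitive $p^m$-th root of unity. If $q\equiv 1\pmod 4$ or $p$ is odd, then the primitive idempotents of $\mathbb{F}_q[x]/\langle x^{p^k}-1\rangle$ are of the following forms: (1) For each $0\le j\le p^m-1$, $$e_j(x)=\frac{1}{p^k}\sum_{l=0}^{p^k-1}\zeta_{p^m}^{-jl}\,x^l.$$ (2) For each $m<s\le k$ and each $0<l<p^m$ such that $\gcd(l,p)=1$, $$e_{s,l}(x)=\frac{1}{p^{k+m-s}}\sum_{j=0}^{p^{k-s+m}-1}\zeta_{p^m}^{-lj}\,x^{p^{s-m}j}.$$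
   Context: The notation $p^m\,\|\,N$ means that $p^m\mid N$ and $p^{m+1}\nmid N$. Since $p^m\mid q-1$, the field $\mathbb{F}_q$ contains a primitive $p^m$-th root of unity; $\zeta_{p^m}$ is a fixed one. Elements of $\mathbb{F}_q[x]/\langle x^{p^k}-1\rangle$ are written as polynomials representing their classes. *)

theory Defs
  imports "HOL-Algebra.Algebraic_Closure_Type" "HOL-Algebra.QuotRing" "HOL-Library.Cardinality"
begin

definition exactly_divides :: "nat \<Rightarrow> nat \<Rightarrow> nat \<Rightarrow> bool" where
  "exactly_divides p m N \<longleftrightarrow> p ^ m dvd N \<and> \<not> p ^ (m + 1) dvd N"

definition primitive_root_of_unity :: "nat \<Rightarrow> 'a::comm_ring_1 \<Rightarrow> bool" where
  "primitive_root_of_unity n z \<longleftrightarrow>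
     0 < n \<and> z ^ n = 1 \<and> (\<forall>d. 0 < d \<and> d < n \<longrightarrow> z ^ d \<noteq> 1)"

definition ring_idempotent :: "('a, 'b) ring_scheme \<Rightarrow> 'a \<Rightarrow> bool" where
  "ring_idempotent R e \<longleftrightarrow> e \<in> carrier R \<and> e \<otimes>\<^bsub>R\<^esub> e = e"

definition primitive_idempotent :: "('a, 'b) ring_scheme \<Rightarrow> 'a \<Rightarrow> bool" where
  "primitive_idempotent R e \<longleftrightarrow>
     ring_idempotent R e \<and> e \<noteq> \<zero>\<^bsub>R\<^esub> \<and>
     \<not> (\<exists>f g. ring_idempotent R f \<and> ring_idempotent R g \<and>
              f \<noteq> \<zero>\<^bsub>R\<^esub> \<and> g \<noteq> \<zero>\<^bsub>R\<^esub> \<and>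
              f \<otimes>\<^bsub>R\<^esub> g = \<zero>\<^bsub>R\<^esub> \<and> g \<otimes>\<^bsub>R\<^esub> f = \<zero>\<^bsub>R\<^esub> \<and>
              e = f \<oplus>\<^bsub>R\<^esub> g)"

definition poly_ring_of_type :: "'a::field poly ring" where
  "poly_ring_of_type = ring_of_type_algebra"

definition cyclic_ideal :: "nat \<Rightarrow> 'a::field poly set" where
  "cyclic_ideal n = PIdl\<^bsub>poly_ring_of_type\<^esub> (Polynomial.monom 1 n - 1)"

definition cyclic_quotient :: "nat \<Rightarrow> 'a::field poly set ring" where
  "cyclic_quotient n = poly_ring_of_type Quot cyclic_ideal n"

definition cyclic_class :: "nat \<Rightarrow> 'a::field poly \<Rightarrow> 'a poly set" where
  "cyclic_class n f = cyclic_ideal n +>\<^bsub>poly_ring_of_type\<^esub> f"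

definition idem_poly1 :: "nat \<Rightarrow> nat \<Rightarrow> 'a::field \<Rightarrow> nat \<Rightarrow> 'a poly" where
  "idem_poly1 p k z j =
     Polynomial.smult (1 / of_nat (p ^ k))
       (\<Sum>l = 0..p ^ k - 1. Polynomial.monom (z powi (- int (j * l))) l)"

(* Meant for m < s <= k, so that none of the subtractions of exponents truncates. *)
definition idem_poly2 ::
  "nat \<Rightarrow> nat \<Rightarrow> nat \<Rightarrow> 'a::field \<Rightarrow> nat \<Rightarrow> nat \<Rightarrow> 'a poly" where
  "idem_poly2 p k m z s l =
     Polynomial.smult (1 / of_nat (p ^ (k + m - s)))
       (\<Sum>j = 0..p ^ (k - s + m) - 1.
          Polynomial.monom (z powi (- int (l * j))) (p ^ (s - m) * j))"

end

theory Submission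
  imports Defs "HOL-Number_Theory.Residues"
begin

text \<open>
  Write \<open>n = p^k\<close> and \<open>P = X^n - 1\<close>. The quotient by \<open>P\<close> is a product of fields, one for each
  irreducible factor \<open>f\<close> of \<open>P\<close>, and its primitive idempotents are the elements that are \<open>1\<close> in one
  of these fields and \<open>0\<close> in all the others. In terms of polynomials: \<open>e\<close> belongs to \<open>f\<close> iff
  \<open>P\<close> divides \<open>e * f\<close> and \<open>f\<close> divides \<open>e - 1\<close>. These two divisibilities carry
  the proof. They make the class of \<open>e\<close> primitive
  (\<open>primitive_idempotent_of_prime_factor\<close>), and a primitive idempotent \<open>g\<close> that is not divisible by
  \<open>f\<close> has the class of \<open>e\<close> (\<open>primitive_idempotent_from_prime_factor\<close>). The list of idempotents is
  complete once an idempotent divisible by every factor on the list must vanish; for this it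
  suffices that \<open>P\<close> divides a power of every polynomial with these divisors
  (\<open>primitive_idempotents_eq\<close>).

  Every factor has the form \<open>X^r - w\<close> with \<open>r * M = n\<close> and \<open>w^M = 1\<close>. Put \<open>v = X^r / w\<close>. As
  \<open>(v - 1) * (1 + v + ... + v^(M-1)) = v^M - 1 = P\<close>, the mean of \<open>1, v, ..., v^(M-1)\<close> satisfies both
  divisibilities (\<open>factor_idempotent_dvd\<close>). For \<open>r = 1\<close>, \<open>w = \<zeta>^j\<close> it is \<open>e_j\<close>; for
  \<open>r = p^(s-m)\<close>, \<open>w = \<zeta>^l\<close> it is \<open>e_{s,l}\<close>.

  That these binomials exhaust the factors follows by splitting
  \<open>X^(p^(t+1)) - \<zeta>^(l' p)\<close> into the polynomials \<open>X^(p^t) - \<zeta>^i\<close> with \<open>\<zeta>^(i p) = \<zeta>^(l' p)\<close>, repeatedly,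
  until the exponent of \<open>\<zeta>\<close> is prime to \<open>p\<close> or \<open>t = 0\<close> (\<open>monom_diff_1_dvd_power\<close>).

  The main point is that \<open>X^(p^t) - a\<close> is irreducible when \<open>a\<close> has order exactly \<open>p^m\<close>
  and \<open>p^m\<close> is the exact power of \<open>p\<close> in \<open>q - 1\<close> (\<open>irreducible_monom_diff_const\<close>). The latter holds
  if \<open>m < k\<close>; for \<open>m = k\<close> there are only linear factors. Let \<open>f\<close> be
  an irreducible factor, of degree \<open>d\<close>. Modulo \<open>f\<close> the
  class of \<open>X\<close> has order \<open>p^(m+t)\<close>, and it is a unit of a field with \<open>q^d\<close> elements, so that
  \<open>p^(m+t)\<close> divides \<open>q^d - 1\<close>. But passing from \<open>q - 1\<close>
  to \<open>q^d - 1\<close> gains only as many factors \<open>p\<close> as \<open>d\<close> contains (\<open>prime_power_dvd_exponent\<close>). Hence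
  \<open>p^t\<close> divides \<open>d\<close>, and \<open>f\<close> is the whole polynomial up to a constant.
  For \<open>p = 2\<close> the statement about \<open>q^d - 1\<close>
  requires \<open>q \<equiv> 1\<close> modulo \<open>4\<close>: already \<open>3^2 - 1 = 8\<close> gains two factors \<open>2\<close> over \<open>3 - 1\<close>.
\<close>

section \<open>Powers of a prime dividing \<open>Q^d - 1\<close>\<close>

text \<open>
  For odd \<open>p\<close> and \<open>Q = 1 + p * c\<close>, modulo \<open>p^2\<close> the \<open>i\<close>-th power of \<open>Q\<close> is \<open>1 + i * p * c\<close>, and the
  sum of the \<open>i * p * c\<close> vanishes because \<open>0 + 1 + ... + (p - 1)\<close> is a multiple of \<open>p\<close>; the sum
  is therefore \<open>p\<close>. For \<open>p = 2\<close> it is \<open>1 + Q\<close>, where \<open>Q \<equiv> 1\<close> modulo \<open>4\<close> excludes the factor \<open>4\<close>.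
\<close>
lemma geometric_sum_exact_prime:
  fixes Q :: int and p :: nat
  assumes p: "Factorial_Ring.prime p" and dvd: "int p dvd Q - 1"
    and two: "odd p \<or> 4 dvd Q - 1"
  shows "\<exists>s. (\<Sum>i<p. Q ^ i) = int p * s \<and> \<not> int p dvd s"
proof (cases "odd p")
  case True
  obtain c where c: "Q = 1 + int p * c" using dvd by (metis dvdE diff_add_cancel add.commute)
  define P where "P = int p"
  have pow: "[Q ^ i = 1 + int i * (P * c)] (mod P\<^sup>2)" for i
  proof (induction i)
    case (Suc i)
    have "[Q ^ Suc i = (1 + P * c) * (1 + int i * (P * c))] (mod P\<^sup>2)"
      using cong_mult[OF cong_refl Suc, of Q] by (simp add: c P_def)
    moreover have "(1 + P * c) * (1 + int i * (P * c)) = 1 + int (Suc i) * (P * c) + P\<^sup>2 * (int i * c\<^sup>2)"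
      by (simp add: algebra_simps power2_eq_square)
    ultimately show ?case by (simp add: cong_def)
  qed simp
  have "[(\<Sum>i<p. Q ^ i) = (\<Sum>i<p. 1 + int i * (P * c))] (mod P\<^sup>2)"
    by (rule cong_sum) (rule pow)
  moreover have "(\<Sum>i<p. 1 + int i * (P * c)) = P + (\<Sum>i<p. int i) * (P * c)"
    by (simp add: sum.distrib sum_distrib_right P_def)
  \<comment> \<open>\<open>p\<close> odd makes \<open>0 + 1 + ... + (p - 1) = p * h\<close> a multiple of \<open>p\<close>\<close>
  moreover obtain h where h: "p = 2 * h + 1" using True by (metis oddE)
  moreover have "(\<Sum>i<2 * h + 1. int i) = int (2 * h + 1) * int h" for h
    by (induction h) (auto simp: algebra_simps)
  then have "(\<Sum>i<p. int i) = P * int h" unfolding h P_def .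
  ultimately have "[(\<Sum>i<p. Q ^ i) = P + P\<^sup>2 * (int h * c)] (mod P\<^sup>2)"
    by (simp add: power2_eq_square mult_ac)
  then have "P\<^sup>2 dvd (\<Sum>i<p. Q ^ i) - (P + P\<^sup>2 * (int h * c))"
    by (simp add: cong_iff_dvd_diff)
  then obtain u where u: "(\<Sum>i<p. Q ^ i) = P + P\<^sup>2 * (int h * c) + P\<^sup>2 * u"
    by (metis dvdE diff_add_cancel add.commute)
  have "(\<Sum>i<p. Q ^ i) = P * (1 + P * (int h * c + u))"
    unfolding u by (simp add: algebra_simps power2_eq_square)
  moreover have "\<not> P dvd 1 + P * (int h * c + u)"
  proof
    assume "P dvd 1 + P * (int h * c + u)"
    then have "P dvd 1" by (simp add: dvd_add_left_iff)
    then show False using p by (simp add: P_def)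
  qed
  ultimately show ?thesis by (auto simp: P_def)
next
  case False
  then have "p = 2" using p prime_odd_nat by (metis prime_ge_2_nat le_neq_implies_less)
  moreover obtain c where "Q = 1 + 4 * c" using two False by (metis dvdE diff_add_cancel add.commute)
  ultimately show ?thesis
    by (intro exI[of _ "1 + 2 * c"]) (auto simp: numeral_2_eq_2)
qed

text \<open>
  Each \<open>p\<close>-th power gains at most one factor \<open>p\<close>, since
  \<open>R^p - 1 = (R - 1) * (1 + R + ... + R^(p-1))\<close> and \<open>p\<close> divides the second factor exactly once.
\<close>
lemma prime_power_not_dvd_power_prime_power:
  fixes Q :: int and p :: nat
  assumes p: "Factorial_Ring.prime p" and dvd: "int p dvd Q - 1"
    and two: "odd p \<or> 4 dvd Q - 1" and nd: "\<not> int p ^ a dvd Q - 1"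
  shows "\<not> int p ^ (a + t) dvd Q ^ (p ^ t) - 1"
proof (induction t)
  case (Suc t)
  let ?R = "Q ^ (p ^ t)"
  have base: "Q - 1 dvd ?R - 1" by (metis dvd_triv_left power_diff_1_eq)
  obtain s where s: "(\<Sum>i<p. ?R ^ i) = int p * s" "\<not> int p dvd s"
    using geometric_sum_exact_prime[OF p, of ?R] dvd two base by (metis dvd_trans)
  show ?case
  proof
    assume "int p ^ (a + Suc t) dvd Q ^ (p ^ Suc t) - 1"
    also have "Q ^ (p ^ Suc t) - 1 = (?R - 1) * (\<Sum>i<p. ?R ^ i)"
      by (metis power_diff_1_eq power_mult power_Suc2)
    also have "\<dots> = int p * ((?R - 1) * s)" by (simp add: s)
    finally have "int p ^ (a + t) dvd (?R - 1) * s"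
      using p by simp
    moreover have "coprime (int p ^ (a + t)) s"
      using p s(2) by (simp add: prime_imp_coprime)
    ultimately have "int p ^ (a + t) dvd ?R - 1"
      by (simp add: coprime_dvd_mult_left_iff)
    then show False using Suc by simp
  qed
qed (use nd in simp)

text \<open>
  The form of lifting the exponent that bounds degrees below. If \<open>d = p^t * e\<close> and
  \<open>R = Q^(p^t)\<close>, then \<open>R^e - 1 = (R - 1) * (1 + R + ... + R^(e-1))\<close>, where \<open>R - 1\<close> has too few factors
  \<open>p\<close>, while the second factor is \<open>e\<close> modulo \<open>p\<close>; so \<open>p\<close> divides \<open>e\<close>.
\<close>
lemma prime_power_dvd_exponent:
  fixes Q :: int and p :: nat
  assumes p: "Factorial_Ring.prime p" and dvd: "int p dvd Q - 1"
    and two: "odd p \<or> 4 dvd Q - 1" and nd: "\<not> int p ^ Suc m dvd Q - 1"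
    and pow: "int p ^ (m + t) dvd Q ^ d - 1"
  shows "p ^ t dvd d"
  using pow
proof (induction t)
  case (Suc t)
  have "int p ^ (m + t) dvd Q ^ d - 1"
    using Suc.prems by (meson dvd_trans le_imp_power_dvd add_le_mono le_SucI order_refl)
  then obtain e where e: "d = p ^ t * e" using Suc.IH by blast
  let ?R = "Q ^ (p ^ t)"
  have base: "Q - 1 dvd ?R - 1" by (metis dvd_triv_left power_diff_1_eq)
  then have "[?R = 1] (mod int p)" using dvd by (meson cong_iff_dvd_diff dvd_trans)
  then have "[(\<Sum>i<e. ?R ^ i) = (\<Sum>i<e. 1 ^ i)] (mod int p)"
    by (intro cong_sum cong_pow)
  then have sum: "[(\<Sum>i<e. ?R ^ i) = int e] (mod int p)" by simp
  have "int p ^ (m + Suc t) dvd (?R - 1) * (\<Sum>i<e. ?R ^ i)"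
    using Suc.prems by (simp only: e power_mult power_diff_1_eq)
  moreover have "\<not> int p ^ (m + Suc t) dvd ?R - 1"
    using prime_power_not_dvd_power_prime_power[OF p dvd two nd, of t] by simp
  ultimately have "\<not> coprime (int p ^ (m + Suc t)) (\<Sum>i<e. ?R ^ i)"
    by (auto simp: coprime_dvd_mult_left_iff)
  then have "int p dvd (\<Sum>i<e. ?R ^ i)"
    using p by (meson prime_imp_coprime prime_nat_int_transfer coprime_power_left_iff)
  then have "p dvd e" using sum by (simp add: cong_dvd_iff)
  then show ?case by (simp add: e mult.commute)
qed simp

section \<open>Idempotents of the quotient in terms of divisibility\<close>

text \<open>
  With the next lemmas this turns statements about cosets into divisibility by \<open>X^n - 1\<close> in the
  polynomial ring, where all further arguments take place.
\<close>
lemma cyclic_class_eq_iff: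
  fixes f g :: "'a::field poly"
  shows "cyclic_class n f = cyclic_class n g \<longleftrightarrow> Polynomial.monom 1 n - 1 dvd f - g"
proof -
  have cc: "cyclic_class n f = {h. Polynomial.monom 1 n - 1 dvd h - f}" for f :: "'a poly"
  proof (rule Set.set_eqI)
    fix h
    have "h \<in> cyclic_class n f \<longleftrightarrow> (\<exists>c. h = c * (Polynomial.monom 1 n - 1) + f)"
      by (auto simp: cyclic_class_def cyclic_ideal_def poly_ring_of_type_def
          ring_of_type_algebra_def a_r_coset_def r_coset_def cgenideal_def)
    also have "\<dots> \<longleftrightarrow> (\<exists>c. h - f = (Polynomial.monom 1 n - 1) * c)"
      by (simp only: diff_eq_eq mult.commute)
    finally show "h \<in> cyclic_class n f \<longleftrightarrow> h \<in> {h. Polynomial.monom 1 n - 1 dvd h - f}"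
      by (simp add: dvd_def)
  qed
  show ?thesis unfolding cc
  proof
    assume "{h. Polynomial.monom 1 n - 1 dvd h - f} = {h. Polynomial.monom 1 n - 1 dvd h - g}"
    then have "f \<in> {h. Polynomial.monom 1 n - 1 dvd h - g}" by auto
    then show "Polynomial.monom 1 n - 1 dvd f - g" by simp
  next
    assume d: "Polynomial.monom 1 n - 1 dvd f - g"
    have "Polynomial.monom 1 n - 1 dvd h - f \<longleftrightarrow> Polynomial.monom 1 n - 1 dvd h - g" for h
      using dvd_add_left_iff[OF d, of "h - f"] by simp
    then show "{h. Polynomial.monom 1 n - 1 dvd h - f} = {h. Polynomial.monom 1 n - 1 dvd h - g}" by simp
  qed
qed

lemma ideal_cyclic_ideal: "ideal (cyclic_ideal n :: 'a::field poly set) poly_ring_of_type"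
proof -
  interpret cring "poly_ring_of_type :: 'a poly ring"
    unfolding poly_ring_of_type_def by (rule cring_from_type_algebra)
  show ?thesis unfolding cyclic_ideal_def
    by (rule cgenideal_ideal) (simp add: poly_ring_of_type_def ring_of_type_algebra_def)
qed

lemma cyclic_quotient_simps:
  fixes f g :: "'a::field poly"
  shows "carrier (cyclic_quotient n) = range (cyclic_class n :: 'a poly \<Rightarrow> _)"
    and "cyclic_class n f \<otimes>\<^bsub>cyclic_quotient n\<^esub> cyclic_class n g = cyclic_class n (f * g)"
    and "cyclic_class n f \<oplus>\<^bsub>cyclic_quotient n\<^esub> cyclic_class n g = cyclic_class n (f + g)"
    and "\<zero>\<^bsub>cyclic_quotient n\<^esub> = cyclic_class n (0 :: 'a poly)"
proof -
  interpret ideal "cyclic_ideal n" "poly_ring_of_type :: 'a poly ring"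
    by (rule ideal_cyclic_ideal)
  note ops = poly_ring_of_type_def ring_of_type_algebra_def
  show "carrier (cyclic_quotient n) = range (cyclic_class n :: 'a poly \<Rightarrow> _)"
    by (auto simp: cyclic_quotient_def FactRing_def A_RCOSETS_def' cyclic_class_def ops)
  show "cyclic_class n f \<otimes>\<^bsub>cyclic_quotient n\<^esub> cyclic_class n g = cyclic_class n (f * g)"
    using rcoset_mult_add[of f g] by (simp add: cyclic_quotient_def FactRing_def cyclic_class_def ops)
  show "cyclic_class n f \<oplus>\<^bsub>cyclic_quotient n\<^esub> cyclic_class n g = cyclic_class n (f + g)"
    using a_rcos_sum[of f g] by (simp add: cyclic_quotient_def FactRing_def cyclic_class_def ops)
  show "\<zero>\<^bsub>cyclic_quotient n\<^esub> = cyclic_class n (0 :: 'a poly)"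
    by (auto simp: cyclic_quotient_def FactRing_def cyclic_class_def a_r_coset_def r_coset_def ops)
qed

lemma primitive_idempotent_cyclic_class_iff:
  fixes g :: "'a::field poly"
  defines "P n \<equiv> Polynomial.monom 1 n - 1 :: 'a poly"
  shows "primitive_idempotent (cyclic_quotient n) (cyclic_class n g) \<longleftrightarrow>
    P n dvd g * g - g \<and> \<not> P n dvd g \<and>
    (\<forall>a b. P n dvd a * a - a \<longrightarrow> P n dvd b * b - b \<longrightarrow> P n dvd a * b \<longrightarrow>
       P n dvd g - (a + b) \<longrightarrow> P n dvd a \<or> P n dvd b)"
  unfolding primitive_idempotent_def ring_idempotent_def P_def
  by (auto simp: cyclic_quotient_simps cyclic_class_eq_iff mult.commute)

text \<open>
  In a decomposition \<open>e = a + b\<close> into orthogonal idempotents the prime \<open>f\<close> divides \<open>a * b\<close>, hence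
  one of them, say \<open>a\<close>. Multiples of \<open>f\<close> are annihilated by \<open>e\<close>, whereas \<open>e * a = a\<close> by
  orthogonality; so \<open>a\<close> is zero.
\<close>
lemma primitive_idempotent_of_prime_factor:
  fixes f e :: "'a::field poly"
  assumes prime: "prime_elem f" and fP: "f dvd Polynomial.monom 1 n - 1"
    and ef: "Polynomial.monom 1 n - 1 dvd e * f" and e1: "f dvd e - 1"
  shows "primitive_idempotent (cyclic_quotient n) (cyclic_class n e)"
  unfolding primitive_idempotent_cyclic_class_iff
proof (intro conjI allI impI)
  let ?P = "Polynomial.monom 1 n - 1 :: 'a poly"
  have kill: "?P dvd e * a" if "f dvd a" for a
    using that ef by (metis dvd_trans dvd_refl mult_dvd_mono)
  show "?P dvd e * e - e" using kill[OF e1] by (simp add: algebra_simps)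
  show "\<not> ?P dvd e"
  proof
    assume "?P dvd e"
    then have "f dvd e" using fP by (rule dvd_trans[rotated])
    then have "f dvd e - (e - 1)" using e1 by (rule dvd_diff)
    then show False using prime by simp
  qed
  fix a b
  assume a: "?P dvd a * a - a" and b: "?P dvd b * b - b" and ab: "?P dvd a * b"
    and e: "?P dvd e - (a + b)"
  have absorb: "?P dvd c" if "f dvd c" "?P dvd c * c - c" "?P dvd c * c'" "?P dvd e - (c + c')" for c c'
  proof -
    have "c = e * c - c * (e - (c + c')) - (c * c - c) - c * c'" by (simp add: algebra_simps)
    then show ?thesis using kill[OF that(1)] that(2-4) by (metis dvd_diff dvd_mult)
  qed
  have "f dvd a * b" using fP ab by (rule dvd_trans)
  then have "f dvd a \<or> f dvd b" using prime by (simp add: prime_elem_dvd_mult_iff)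
  then show "?P dvd a \<or> ?P dvd b"
  proof
    assume "f dvd a"
    then show ?thesis using absorb a ab e by blast
  next
    assume "f dvd b"
    moreover have "?P dvd b * a" "?P dvd e - (b + a)" using ab e by (simp_all add: ac_simps)
    ultimately show ?thesis using absorb b by blast
  qed
qed

text \<open>
  From \<open>g * (g - 1) = 0\<close> the prime \<open>f\<close> divides \<open>g - 1\<close>, so \<open>e * g = e\<close> in the quotient. Then
  \<open>g = e + (g - e)\<close> is a decomposition into orthogonal idempotents, and primitivity of \<open>g\<close> leaves
  only \<open>g - e = 0\<close>.
\<close>
lemma primitive_idempotent_from_prime_factor:
  fixes f e g :: "'a::field poly"
  assumes prime: "prime_elem f" and fP: "f dvd Polynomial.monom 1 n - 1"
    and ef: "Polynomial.monom 1 n - 1 dvd e * f" and e1: "f dvd e - 1"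
    and g: "primitive_idempotent (cyclic_quotient n) (cyclic_class n g)" and fg: "\<not> f dvd g"
  shows "cyclic_class n g = cyclic_class n e"
proof -
  let ?P = "Polynomial.monom 1 n - 1 :: 'a poly"
  have kill: "?P dvd e * a" if "f dvd a" for a
    using that ef by (metis dvd_trans dvd_refl mult_dvd_mono)
  have gg: "?P dvd g * g - g" using g by (simp add: primitive_idempotent_cyclic_class_iff)
  have e: "?P dvd e * e - e" "\<not> ?P dvd e"
    using primitive_idempotent_of_prime_factor[OF prime fP ef e1]
    by (simp_all add: primitive_idempotent_cyclic_class_iff)
  have "f dvd g * (g - 1)" using dvd_trans[OF fP gg] by (simp add: algebra_simps)
  then have eg: "?P dvd e * (g - 1)" using kill fg prime prime_elem_dvd_mult_iff by blast
  have "(g - e) * (g - e) - (g - e) = (g * g - g) - 2 * (e * (g - 1)) + (e * e - e)"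
    by (simp add: algebra_simps)
  then have b: "?P dvd (g - e) * (g - e) - (g - e)"
    using gg eg e(1) by (metis dvd_add dvd_diff dvd_mult)
  have "e * (g - e) = e * (g - 1) - (e * e - e)" by (simp add: algebra_simps)
  then have ab: "?P dvd e * (g - e)" using eg e(1) by (metis dvd_diff)
  have "?P dvd g - (e + (g - e))" by simp
  then have "?P dvd g - e"
    using g e b ab unfolding primitive_idempotent_cyclic_class_iff by blast
  then show ?thesis by (simp add: cyclic_class_eq_iff)
qed

lemma idempotent_dvd_if_dvd_power:
  fixes g P :: "'a::comm_ring_1"
  assumes gg: "P dvd g * g - g" and "P dvd g ^ N"
  shows "P dvd g"
proof -
  have "P dvd g ^ Suc i - g" for i
  proof (induction i)
    case (Suc i)
    have "g ^ Suc (Suc i) - g = g * (g ^ Suc i - g) + (g * g - g)" by (simp add: algebra_simps)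
    then show ?case using Suc gg by (metis dvd_add dvd_mult)
  qed simp
  moreover have "P dvd g ^ Suc N" using assms(2) by simp
  ultimately have "P dvd g ^ Suc N - (g ^ Suc N - g)" by (metis dvd_diff)
  then show ?thesis by simp
qed

text \<open>
  A set \<open>I\<close> of prime factors with their idempotents gives all primitive idempotents if every
  polynomial divisible by all the factors is nilpotent modulo \<open>X^n - 1\<close>: a nonzero idempotent is
  not nilpotent, so some factor \<open>f\<close> does not divide it, and then it is the idempotent of \<open>f\<close>.
\<close>
lemma primitive_idempotents_eq:
  fixes I :: "('a::field poly \<times> 'a poly) set"
  assumes I: "\<And>f e. (f, e) \<in> I \<Longrightarrow> prime_elem f \<and> f dvd Polynomial.monom 1 n - 1 \<and>
      Polynomial.monom 1 n - 1 dvd e * f \<and> f dvd e - 1"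
    and exhaust: "\<And>g. (\<And>f e. (f, e) \<in> I \<Longrightarrow> f dvd g) \<Longrightarrow> \<exists>N. Polynomial.monom 1 n - 1 dvd g ^ N"
  shows "{E. primitive_idempotent (cyclic_quotient n) E} = cyclic_class n ` snd ` I"
proof (intro equalityI subsetI)
  fix E assume "E \<in> cyclic_class n ` snd ` I"
  then show "E \<in> {E. primitive_idempotent (cyclic_quotient n) E}"
    using I primitive_idempotent_of_prime_factor by fastforce
next
  fix E :: "'a poly set"
  assume "E \<in> {E. primitive_idempotent (cyclic_quotient n) E}"
  then have E: "primitive_idempotent (cyclic_quotient n) E" by simp
  then obtain g where g: "E = cyclic_class n g"
    by (auto simp: primitive_idempotent_def ring_idempotent_def cyclic_quotient_simps)
  have "\<exists>f e. (f, e) \<in> I \<and> \<not> f dvd g"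
  proof (rule ccontr)
    assume "\<nexists>f e. (f, e) \<in> I \<and> \<not> f dvd g"
    then obtain N where "Polynomial.monom 1 n - 1 dvd g ^ N" using exhaust by blast
    then show False using E idempotent_dvd_if_dvd_power
      unfolding g primitive_idempotent_cyclic_class_iff by blast
  qed
  then obtain f e where "(f, e) \<in> I" "\<not> f dvd g" by blast
  then have "E = cyclic_class n e"
    using I[of f e] primitive_idempotent_from_prime_factor[of f n e g] E g by blast
  then show "E \<in> cyclic_class n ` snd ` I" using \<open>(f, e) \<in> I\<close> by force
qed

section \<open>Roots of unity and factors of \<open>X^n - 1\<close>\<close>

lemma primitive_root_power_eq_1_iff:
  fixes z :: "'a::comm_ring_1"
  assumes "primitive_root_of_unity n z"
  shows "z ^ i = 1 \<longleftrightarrow> n dvd i"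
proof -
  have n: "0 < n" "z ^ n = 1" and least: "\<And>d. 0 < d \<Longrightarrow> d < n \<Longrightarrow> z ^ d \<noteq> 1"
    using assms by (auto simp: primitive_root_of_unity_def)
  have "z ^ i = z ^ (n * (i div n) + i mod n)" by simp
  also have "\<dots> = z ^ (i mod n)" by (simp only: power_add power_mult n(2)) simp
  finally have "z ^ i = z ^ (i mod n)" .
  then show ?thesis using least[of "i mod n"] n(1) by (auto simp: dvd_eq_mod_eq_0)
qed

lemma primitive_root_powers_inj:
  fixes z :: "'a::field"
  assumes "primitive_root_of_unity n z"
  shows "inj_on (\<lambda>i. z ^ i) {..<n}"
proof (rule linorder_inj_onI)
  fix i j assume ij: "i < j" "i \<in> {..<n}" "j \<in> {..<n}"
  show "z ^ i \<noteq> z ^ j"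
  proof
    assume "z ^ i = z ^ j"
    moreover have "z ^ j = z ^ i * z ^ (j - i)" using ij by (simp flip: power_add)
    moreover have "z \<noteq> 0" using assms by (auto simp: primitive_root_of_unity_def power_0_left)
    ultimately have "z ^ (j - i) = 1" by simp
    then have "n dvd j - i" using assms by (simp add: primitive_root_power_eq_1_iff)
    then show False using ij by (auto dest: dvd_imp_le)
  qed
qed auto

lemma primitive_root_of_unity_power:
  fixes z :: "'a::comm_ring_1"
  assumes "primitive_root_of_unity (a * b) z"
  shows "primitive_root_of_unity b (z ^ a)"
proof -
  have "0 < a" "0 < b" using assms by (auto simp: primitive_root_of_unity_def)
  then show ?thesis
    using primitive_root_power_eq_1_iff[OF assms]
    by (auto simp: primitive_root_of_unity_def simp flip: power_mult dest: dvd_imp_le)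
qed

text \<open>
  For \<open>y = X\<close> both sides are monic of degree \<open>n\<close> and vanish at the \<open>n\<close> distinct points
  \<open>c * \<omega>^i\<close>; the general case follows by substituting \<open>y\<close> for \<open>X\<close>.
\<close>
lemma power_diff_const_power_eq_prod:
  fixes c \<omega> :: "'a::field"
  assumes \<omega>: "primitive_root_of_unity n \<omega>" and c: "c \<noteq> 0"
  shows "y ^ n - [:c ^ n:] = (\<Prod>i<n. y - [:c * \<omega> ^ i:])"
proof -
  have n: "0 < n" "\<omega> ^ n = 1" using \<omega> by (auto simp: primitive_root_of_unity_def)
  let ?X = "[:0, 1:] :: 'a poly"
  let ?A = "(\<lambda>i. c * \<omega> ^ i) ` {..<n}"
  have Xn: "?X ^ n = Polynomial.monom 1 n" by (simp add: monom_altdef)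
  have lin: "?X - [:a:] = [:- a, 1:]" for a by simp
  have deg: "Polynomial.degree (\<Prod>i<n. ?X - [:c * \<omega> ^ i:]) = n"
    unfolding lin by (subst degree_prod_eq_sum_degree) auto
  have "?X ^ n - [:c ^ n:] = (\<Prod>i<n. ?X - [:c * \<omega> ^ i:])"
  proof (rule poly_eqI_degree_lead_coeff[where A = ?A and n = n])
    have "Polynomial.lead_coeff (\<Prod>i<n. ?X - [:c * \<omega> ^ i:]) = 1"
      unfolding lin by (simp add: lead_coeff_prod)
    then have "Polynomial.coeff (\<Prod>i<n. ?X - [:c * \<omega> ^ i:]) n = 1" by (simp only: deg)
    moreover have "Polynomial.coeff (?X ^ n - [:c ^ n:]) n = 1"
      using n(1) unfolding Xn by (simp add: coeff_pCons split: nat.split)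
    ultimately show "Polynomial.coeff (?X ^ n - [:c ^ n:]) n =
        Polynomial.coeff (\<Prod>i<n. ?X - [:c * \<omega> ^ i:]) n" by simp
    have "inj_on (\<lambda>i. c * \<omega> ^ i) {..<n}"
      using primitive_root_powers_inj[OF \<omega>] c by (simp add: inj_on_def)
    then show "n \<le> card ?A" by (simp add: card_image)
    show "Polynomial.degree (?X ^ n - [:c ^ n:]) \<le> n"
      unfolding Xn by (intro degree_diff_le degree_monom_le) simp
    show "Polynomial.degree (\<Prod>i<n. ?X - [:c * \<omega> ^ i:]) \<le> n" by (simp only: deg)
    fix z assume "z \<in> ?A"
    then obtain i where i: "i < n" "z = c * \<omega> ^ i" by auto
    have "z ^ n = c ^ n * (\<omega> ^ n) ^ i" by (simp add: i power_mult_distrib mult.commute flip: power_mult)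
    then show "poly (?X ^ n - [:c ^ n:]) z = poly (\<Prod>i<n. ?X - [:c * \<omega> ^ i:]) z"
      using i n by (auto simp: poly_prod)
  qed
  then have "pcompose (?X ^ n - [:c ^ n:]) y = pcompose (\<Prod>i<n. ?X - [:c * \<omega> ^ i:]) y" by (rule arg_cong)
  moreover have "pcompose (?X ^ j) y = y ^ j" for j
    by (induction j) (simp_all add: pcompose_mult pcompose_1 pcompose_pCons)
  from this[of 1] this[of n] have "pcompose ?X y = y" "pcompose (?X ^ n) y = y ^ n" by simp_all
  ultimately show ?thesis
    by (simp only: pcompose_diff pcompose_prod pcompose_const)
qed

lemma prod_dvd_power:
  fixes g :: "'a::comm_semiring_1"
  assumes "finite S" and "\<And>i. i \<in> S \<Longrightarrow> \<exists>N. h i dvd g ^ N"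
  shows "\<exists>N. prod h S dvd g ^ N"
  using assms
proof (induction S rule: finite_induct)
  case (insert i S)
  then obtain M N where "h i dvd g ^ M" "prod h S dvd g ^ N" by blast
  then have "h i * prod h S dvd g ^ (M + N)" by (simp add: power_add mult_dvd_mono)
  then show ?case using insert.hyps by auto
qed simp

text \<open>
  The hypotheses say that \<open>g\<close> is divisible by the binomials that are the irreducible factors of
  \<open>X^(p^(m+d)) - 1\<close> when the field is finite and \<open>irreducible_monom_diff_const\<close> applies. By induction on \<open>t\<close> every \<open>X^(p^t) - \<zeta>^l\<close> divides a power of \<open>g\<close>,
  whether or not \<open>p\<close> divides \<open>l\<close>; the product over all \<open>l < p^m\<close> at the last level \<open>t = d\<close> is
  \<open>X^(p^(m+d)) - 1\<close>.
\<close>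
lemma monom_diff_1_dvd_power:
  fixes \<zeta> :: "'a::field" and g :: "'a poly"
  assumes \<zeta>: "primitive_root_of_unity (p ^ m) \<zeta>" and p: "Factorial_Ring.prime p"
    and m: "1 \<le> m"
    and lin: "\<And>j. j < p ^ m \<Longrightarrow> Polynomial.monom 1 1 - [:\<zeta> ^ j:] dvd g"
    and bin: "\<And>t l. 1 \<le> t \<Longrightarrow> t \<le> d \<Longrightarrow> l < p ^ m \<Longrightarrow> \<not> p dvd l \<Longrightarrow>
      Polynomial.monom 1 (p ^ t) - [:\<zeta> ^ l:] dvd g"
  shows "\<exists>N. Polynomial.monom 1 (p ^ (m + d)) - 1 dvd g ^ N"
proof -
  have \<zeta>1: "\<zeta> ^ p ^ m = 1" using \<zeta> by (simp add: primitive_root_of_unity_def)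
  have pm: "0 < p ^ m" using p by (simp add: prime_gt_0_nat)
  then have \<zeta>0: "\<zeta> \<noteq> 0" using \<zeta>1 by (auto simp: power_0_left)
  have reduce: "\<zeta> ^ l = \<zeta> ^ (l mod p ^ m)" for l
  proof -
    have "\<zeta> ^ l = \<zeta> ^ (p ^ m * (l div p ^ m) + l mod p ^ m)" by simp
    also have "\<dots> = \<zeta> ^ (l mod p ^ m)" by (simp only: power_add power_mult \<zeta>1) simp
    finally show ?thesis .
  qed
  have pm_eq: "p ^ m = p ^ (m - 1) * p" using m by (cases m) auto
  \<comment> \<open>the primitive \<open>p\<close>-th root of unity that splits \<open>y^p - c^p\<close>\<close>
  have \<omega>: "primitive_root_of_unity p (\<zeta> ^ p ^ (m - 1))"
    using primitive_root_of_unity_power[of "p ^ (m - 1)" p \<zeta>] \<zeta> pm_eq by simp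
  have level: "\<exists>N. Polynomial.monom 1 (p ^ t) - [:\<zeta> ^ l:] dvd g ^ N" if "t \<le> d" for t l
    using that
  proof (induction t arbitrary: l)
    case 0
    have "Polynomial.monom 1 1 - [:\<zeta> ^ l:] dvd g ^ 1"
      using lin[of "l mod p ^ m"] pm by (simp flip: reduce)
    then show ?case by (simp only: power_0) blast
  next
    case (Suc t)
    show ?case
    proof (cases "p dvd l")
      case False
      then have "\<not> p dvd l mod p ^ m" using m by (simp add: dvd_mod_iff)
      then have "Polynomial.monom 1 (p ^ Suc t) - [:\<zeta> ^ l:] dvd g ^ 1"
        using bin[of "Suc t" "l mod p ^ m"] pm Suc.prems by (simp flip: reduce)
      then show ?thesis by blast
    next
      case True
      then obtain l' where l: "l = l' * p" by (metis dvdE mult.commute)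
      have "Polynomial.monom 1 (p ^ Suc t) - [:\<zeta> ^ l:] =
          Polynomial.monom 1 (p ^ t) ^ p - [:(\<zeta> ^ l') ^ p:]"
        by (simp add: monom_power l mult.commute power_mult)
      also have "\<dots> = (\<Prod>i<p. Polynomial.monom 1 (p ^ t) - [:\<zeta> ^ (l' + p ^ (m - 1) * i):])"
        using power_diff_const_power_eq_prod[OF \<omega>, of "\<zeta> ^ l'"] \<zeta>0
        by (simp add: power_add power_mult)
      finally show ?thesis using Suc by (simp add: prod_dvd_power)
    qed
  qed
  have "Polynomial.monom 1 (p ^ (m + d)) - 1 = Polynomial.monom 1 (p ^ d) ^ p ^ m - [:1 ^ p ^ m:]"
    by (simp add: monom_power power_add mult.commute one_pCons)
  also have "\<dots> = (\<Prod>i<p ^ m. Polynomial.monom 1 (p ^ d) - [:\<zeta> ^ i:])"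
    by (subst power_diff_const_power_eq_prod[OF \<zeta>]) simp_all
  finally show ?thesis using level[of d] by (simp add: prod_dvd_power)
qed

section \<open>Irreducible binomials over a finite field\<close>

text \<open>
  Euclid's algorithm on the exponents, since \<open>x^a - 1 = x^(a mod b) * (x^(b * (a div b)) - 1) +
  (x^(a mod b) - 1)\<close>.
\<close>
lemma dvd_power_diff_1_gcd:
  fixes x f :: "'a::comm_ring_1"
  assumes "f dvd x ^ a - 1" and "f dvd x ^ b - 1"
  shows "f dvd x ^ gcd a b - 1"
  using assms
proof (induction a b rule: gcd_nat_induct)
  case (step a b)
  have "x ^ a = x ^ (a mod b) * (x ^ b) ^ (a div b)" by (simp flip: power_mult power_add)
  then have eq: "x ^ (a mod b) - 1 = (x ^ a - 1) - x ^ (a mod b) * ((x ^ b) ^ (a div b) - 1)"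
    by (simp add: algebra_simps)
  have "x ^ b - 1 dvd (x ^ b) ^ (a div b) - 1" by (metis dvd_triv_left power_diff_1_eq)
  then have "f dvd (x ^ b) ^ (a div b) - 1" using step.prems(2) by (rule dvd_trans[rotated])
  then have "f dvd x ^ (a mod b) - 1"
    unfolding eq using dvd_diff[OF step.prems(1) dvd_mult] by blast
  then show ?case using step by (simp add: gcd_red_nat[of a b])
qed simp

text \<open>
  Bounding the coefficients instead of the degree includes the zero polynomial also for \<open>d = 0\<close>.
\<close>
lemma card_bounded_degree_polys:
  "finite {h :: 'a::{field,finite} poly. \<forall>i\<ge>d. Polynomial.coeff h i = 0} \<and>
   card {h :: 'a poly. \<forall>i\<ge>d. Polynomial.coeff h i = 0} = CARD('a) ^ d"
proof (induction d)
  case 0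
  have "{h :: 'a poly. \<forall>i\<ge>0. Polynomial.coeff h i = 0} = {0}" by (auto simp: poly_eq_iff)
  then show ?case by simp
next
  case (Suc d)
  let ?T = "\<lambda>d. {h :: 'a poly. \<forall>i\<ge>d. Polynomial.coeff h i = 0}"
  have "?T (Suc d) = (\<lambda>(a, h). pCons a h) ` (UNIV \<times> ?T d)"
  proof (intro equalityI subsetI)
    fix h assume h: "h \<in> ?T (Suc d)"
    obtain a g where "h = pCons a g" by (rule pCons_cases)
    moreover from this h have "g \<in> ?T d" by (auto simp: coeff_pCons dest: spec[of _ "Suc _"])
    ultimately show "h \<in> (\<lambda>(a, h). pCons a h) ` (UNIV \<times> ?T d)" by auto
  qed (auto simp: coeff_pCons split: nat.split)
  moreover have "inj_on (\<lambda>(a, h). pCons a h) (UNIV \<times> ?T d)" by (auto simp: inj_on_def)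
  ultimately show ?case using Suc by (simp add: card_image card_cartesian_product)
qed

lemma prime_elem_not_dvd_prod:
  assumes "prime_elem f" and "finite S" and "\<And>h. h \<in> S \<Longrightarrow> \<not> f dvd g h"
  shows "\<not> f dvd prod g S"
  using assms(2,3)
proof (induction S rule: finite_induct)
  case empty
  then show ?case using assms(1) by (simp add: prime_elem_not_unit)
next
  case (insert h S)
  then show ?case using assms(1) by (auto simp: prime_elem_dvd_mult_iff)
qed

text \<open>
  Fermat's little theorem in the residue field of \<open>f\<close>, which has \<open>q^d\<close> elements for \<open>d\<close> the degree
  of \<open>f\<close>. Multiplication by \<open>x\<close> permutes the set \<open>S\<close> of nonzero residues, so the product of all
  residues is unchanged when it is multiplied by \<open>x\<close> to the power \<open>card S = q^d - 1\<close>; and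
  this product is invertible modulo \<open>f\<close>.
\<close>
lemma prime_elem_dvd_power_card_diff_1:
  fixes f x :: "'a::{field,finite} poly"
  assumes f: "prime_elem f" and x: "\<not> f dvd x"
  shows "f dvd x ^ (CARD('a) ^ Polynomial.degree f - 1) - 1"
proof -
  let ?d = "Polynomial.degree f"
  define T where "T = {h :: 'a poly. \<forall>i\<ge>?d. Polynomial.coeff h i = 0}"
  have T: "finite T" "card T = CARD('a) ^ ?d" "0 \<in> T"
    using card_bounded_degree_polys[of ?d, where 'a = 'a] by (simp_all add: T_def)
  have T_dvd: "h = 0" if "f dvd h" "h \<in> T" for h
  proof (rule ccontr)
    assume "h \<noteq> 0"
    then have "?d \<le> Polynomial.degree h" using that(1) by (rule dvd_imp_degree_le[rotated])
    then show False using that(2) \<open>h \<noteq> 0\<close> by (auto simp: T_def dest: spec[of _ "Polynomial.degree h"])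
  qed
  have mod_T: "h mod f \<in> T" for h
    using degree_mod_less[of f h] f by (auto simp: T_def intro: Polynomial.coeff_eq_0)
  define S where "S = T - {0}"
  define \<phi> where "\<phi> = (\<lambda>h. (x * h) mod f)"
  have S_dvd: "\<not> f dvd h" if "h \<in> S" for h using T_dvd that by (auto simp: S_def)
  have "\<phi> ` S \<subseteq> S"
    using S_dvd x f mod_T by (auto simp: \<phi>_def S_def prime_elem_dvd_mult_iff simp flip: dvd_eq_mod_eq_0)
  moreover have "inj_on \<phi> S"
  proof (rule inj_onI)
    fix g h assume "g \<in> S" "h \<in> S" "\<phi> g = \<phi> h"
    then have "f dvd x * (g - h)" by (simp add: \<phi>_def mod_eq_dvd_iff algebra_simps)
    then have "f dvd g - h" using f x by (simp add: prime_elem_dvd_mult_iff)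
    moreover have "g - h \<in> T" using \<open>g \<in> S\<close> \<open>h \<in> S\<close> by (simp add: S_def T_def)
    ultimately show "g = h" using T_dvd by fastforce
  qed
  ultimately have bij: "bij_betw \<phi> S S"
    using T(1) by (simp add: bij_betw_def endo_inj_surj S_def)
  have "[(\<Prod>h\<in>S. \<phi> h) = (\<Prod>h\<in>S. x * h)] (mod f)"
    by (rule cong_prod) (simp add: \<phi>_def)
  moreover have "(\<Prod>h\<in>S. \<phi> h) = \<Prod>S" using prod.reindex_bij_betw[OF bij, of "\<lambda>h. h"] .
  ultimately have "[\<Prod>S = x ^ card S * \<Prod>S] (mod f)" by (simp add: prod.distrib)
  then have "f dvd (x ^ card S - 1) * \<Prod>S"
    by (metis (no_types) cong_iff_dvd_diff cong_sym_eq left_diff_distrib mult_1)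
  moreover have "\<not> f dvd \<Prod>S"
    using prime_elem_not_dvd_prod[OF f _ S_dvd, of S] T(1) by (simp add: S_def)
  ultimately have "f dvd x ^ card S - 1" using f by (simp add: prime_elem_dvd_mult_iff)
  moreover have "card S = CARD('a) ^ ?d - 1" using T by (simp add: S_def)
  ultimately show ?thesis by simp
qed

text \<open>
  Modulo \<open>f\<close> one has \<open>X^(p^t) = a\<close>, so \<open>X\<close> raised to \<open>p^(m+t)\<close> is \<open>1\<close>, but raised to
  \<open>p^(m-1+t)\<close> it is the constant \<open>a^(p^(m-1))\<close>, which differs from \<open>1\<close>. The order of \<open>X\<close> is thus
  \<open>p^(m+t)\<close>.
\<close>
lemma exponent_dvd_of_dvd_monom:
  fixes a :: "'a::field" and p :: nat
  assumes p: "Factorial_Ring.prime p" and f: "\<not> is_unit f"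
    and fa: "f dvd Polynomial.monom 1 (p ^ t) - [:a:]"
    and a: "a ^ p ^ m = 1" "a ^ p ^ (m - 1) \<noteq> 1" and m: "1 \<le> m"
    and fe: "f dvd Polynomial.monom 1 1 ^ e - 1"
  shows "p ^ (m + t) dvd e"
proof -
  let ?X = "Polynomial.monom 1 1 :: 'a poly"
  have X: "?X ^ p ^ (i + t) - [:a ^ p ^ i:] = (?X ^ p ^ t) ^ p ^ i - [:a:] ^ p ^ i" for i
    by (simp add: poly_const_pow power_add mult.commute flip: power_mult)
  have fX: "f dvd ?X ^ p ^ (i + t) - [:a ^ p ^ i:]" for i
  proof -
    have "?X ^ p ^ t - [:a:] dvd ?X ^ p ^ (i + t) - [:a ^ p ^ i:]"
      unfolding X by (metis dvd_triv_left power_diff_sumr2)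
    moreover have "f dvd ?X ^ p ^ t - [:a:]" using fa by (simp add: monom_power)
    ultimately show ?thesis by (rule dvd_trans[rotated])
  qed
  have "f dvd ?X ^ p ^ (m + t) - 1" using fX[of m] by (simp add: a one_pCons)
  then have gcd: "f dvd ?X ^ gcd e (p ^ (m + t)) - 1" using fe by (intro dvd_power_diff_1_gcd)
  obtain i where i: "i \<le> m + t" "gcd e (p ^ (m + t)) = p ^ i"
    using divides_primepow_nat[OF p, of "gcd e (p ^ (m + t))" "m + t"] by auto
  have "i = m + t"
  proof (rule ccontr)
    assume "i \<noteq> m + t"
    then have "p ^ i dvd p ^ (m - 1 + t)" using i(1) m by (intro le_imp_power_dvd) simp
    then obtain c where c: "p ^ (m - 1 + t) = p ^ i * c" by blast
    have "?X ^ p ^ i - 1 dvd ?X ^ p ^ (m - 1 + t) - 1"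
      unfolding c power_mult by (metis dvd_triv_left power_diff_1_eq)
    then have "f dvd ?X ^ p ^ (m - 1 + t) - 1" using gcd i(2) by (metis dvd_trans)
    then have "f dvd (?X ^ p ^ (m - 1 + t) - 1) - (?X ^ p ^ (m - 1 + t) - [:a ^ p ^ (m - 1):])"
      using fX by (rule dvd_diff)
    then have "f dvd [:a ^ p ^ (m - 1) - 1:]" by (simp add: one_pCons)
    moreover have "is_unit [:a ^ p ^ (m - 1) - 1:]"
      using a(2) by (intro is_unit_triv) simp
    ultimately show False using f dvd_trans by blast
  qed
  then show ?thesis using i(2) by (metis gcd_dvd1)
qed

lemma irreducible_if_degree_minimal_divisor:
  fixes f h :: "'a::field poly"
  assumes "f dvd h" "h \<noteq> 0" "0 < Polynomial.degree f"
    and least: "\<And>g. g dvd h \<Longrightarrow> 0 < Polynomial.degree g \<Longrightarrow> Polynomial.degree f \<le> Polynomial.degree g"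
  shows "Factorial_Ring.irreducible f"
proof (rule Factorial_Ring.irreducibleI)
  have f0: "f \<noteq> 0" using assms(1,2) by auto
  then show "f \<noteq> 0" .
  show "\<not> is_unit f" using f0 assms(3) by (simp add: is_unit_iff_degree)
  fix g g' assume f: "f = g * g'"
  then have nz: "g \<noteq> 0" "g' \<noteq> 0" using f0 by auto
  have deg: "Polynomial.degree f = Polynomial.degree g + Polynomial.degree g'"
    using nz by (simp add: f degree_mult_eq)
  show "is_unit g \<or> is_unit g'"
  proof (rule ccontr)
    assume "\<not> (is_unit g \<or> is_unit g')"
    then have pos: "0 < Polynomial.degree g" "0 < Polynomial.degree g'" using nz by (auto simp: is_unit_iff_degree)
    have "g dvd h" using f assms(1) by (metis dvd_mult_left)
    then show False using least[of g] pos deg by simp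
  qed
qed

text \<open>
  For an irreducible factor \<open>f\<close> of degree \<open>d\<close>, the order of \<open>X\<close> modulo \<open>f\<close> is \<open>p^(m+t)\<close> and divides
  \<open>q^d - 1\<close>, where \<open>q\<close> is the number of elements of the field. Since \<open>p^m\<close> is the exact power of
  \<open>p\<close> in \<open>q - 1\<close>, lifting the exponent forces \<open>p^t\<close> to divide \<open>d\<close>.
\<close>
lemma irreducible_monom_diff_const:
  fixes a :: "'a::{field,finite}" and p :: nat
  assumes p: "Factorial_Ring.prime p" and m: "1 \<le> m"
    and a: "a ^ p ^ m = 1" "a ^ p ^ (m - 1) \<noteq> 1"
    and q: "p ^ m dvd CARD('a) - 1" "\<not> p ^ Suc m dvd CARD('a) - 1"
    and two: "odd p \<or> 4 dvd CARD('a) - 1"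
  shows "Factorial_Ring.irreducible (Polynomial.monom 1 (p ^ t) - [:a:])"
proof -
  let ?h = "Polynomial.monom 1 (p ^ t) - [:a:]"
  let ?D = "\<lambda>g. g dvd ?h \<and> 0 < Polynomial.degree g"
  have pt: "0 < p ^ t" using p by (simp add: prime_gt_0_nat)
  have deg_h: "Polynomial.degree ?h = p ^ t"
    using pt degree_add_eq_left[of "[:- a:]" "Polynomial.monom 1 (p ^ t)"]
    by (simp add: degree_monom_eq diff_conv_add_uminus del: add_uminus_conv_diff)
  have h0: "?h \<noteq> 0" using deg_h pt by (metis degree_0 less_irrefl)
  have "?D ?h" using deg_h pt by simp
  \<comment> \<open>a nonconstant divisor of least degree is an irreducible factor\<close>
  then obtain f where f: "?D f" "\<And>g. ?D g \<Longrightarrow> Polynomial.degree f \<le> Polynomial.degree g"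
    using ex_has_least_nat[of ?D ?h Polynomial.degree] by blast
  have irr: "Factorial_Ring.irreducible f"
    using f h0 by (intro irreducible_if_degree_minimal_divisor[of f ?h]) auto
  then have prime: "prime_elem f" by (rule field_poly_irreducible_imp_prime)
  then have nu: "\<not> is_unit f" by (rule prime_elem_not_unit)
  have "a \<noteq> 0" using a(1) p by (auto simp: power_0_left prime_gt_0_nat)
  \<comment> \<open>\<open>X\<close> is a unit modulo \<open>f\<close> because \<open>X^(p^t) = a\<close> there\<close>
  have "\<not> f dvd Polynomial.monom 1 1"
  proof
    assume "f dvd Polynomial.monom 1 1"
    moreover have "Polynomial.monom 1 1 dvd Polynomial.monom (1::'a) (p ^ t)"
      using pt by (simp add: monom_1_dvd_iff')
    ultimately have "f dvd Polynomial.monom 1 (p ^ t) - ?h" using f(1) by (metis dvd_diff dvd_trans)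
    then have "f dvd [:a:]" by simp
    moreover have "is_unit [:a:]" using \<open>a \<noteq> 0\<close> by (rule is_unit_triv)
    ultimately show False using nu dvd_trans by blast
  qed
  then have "f dvd Polynomial.monom 1 1 ^ (CARD('a) ^ Polynomial.degree f - 1) - 1"
    by (rule prime_elem_dvd_power_card_diff_1[OF prime])
  then have pow: "p ^ (m + t) dvd CARD('a) ^ Polynomial.degree f - 1"
    using f(1) by (intro exponent_dvd_of_dvd_monom[OF p nu _ a m]) auto
  have cast: "int c dvd int CARD('a) ^ i - 1 \<longleftrightarrow> c dvd CARD('a) ^ i - 1" for c i
  proof -
    have "int CARD('a) ^ i - 1 = int (CARD('a) ^ i - 1)" by (simp add: of_nat_diff Suc_leI)
    then show ?thesis by (simp only: int_dvd_int_iff)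
  qed
  have "p dvd p ^ m" using m by (simp add: dvd_power)
  then have "p dvd CARD('a) - 1" using q(1) by (rule dvd_trans)
  then have "p ^ t dvd Polynomial.degree f"
    using prime_power_dvd_exponent[OF p, of "int CARD('a)" m t "Polynomial.degree f"]
      q(2) two pow cast[of p 1] cast[of 4 1] cast[of "p ^ Suc m" 1]
      cast[of "p ^ (m + t)" "Polynomial.degree f"]
    by (simp only: of_nat_power of_nat_numeral power_one_right simp_thms)
  then have "p ^ t \<le> Polynomial.degree f" using f(1) by (intro dvd_imp_le) auto
  then have least: "Polynomial.degree ?h \<le> Polynomial.degree g"
    if "g dvd ?h" "0 < Polynomial.degree g" for g
    unfolding deg_h using f(2)[of g] that by linarith
  have "0 < Polynomial.degree ?h" unfolding deg_h by (rule pt)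
  then show ?thesis
    by (rule irreducible_if_degree_minimal_divisor[OF dvd_refl h0 _ least])
qed

section \<open>The idempotent of a binomial factor\<close>

text \<open>
  The cardinality of the field is \<open>0\<close> in it and is \<open>1\<close> modulo \<open>p\<close>, so \<open>p\<close> cannot be \<open>0\<close> as well.
  This makes the denominators of the idempotents invertible.
\<close>
lemma of_nat_neq_0_if_dvd_card_diff_1:
  assumes "p dvd CARD('a::{field,finite}) - 1" "1 < p"
  shows "(of_nat p :: 'a) \<noteq> 0"
proof
  assume p0: "(of_nat p :: 'a) = 0"
  obtain c where "CARD('a) - 1 = p * c" using assms(1) by blast
  moreover have "1 \<le> CARD('a)" by (simp add: Suc_leI)
  ultimately have "CARD('a) = Suc (p * c)" by linarith
  then have "of_nat CARD('a) = (1 :: 'a)" using p0 by simp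
  moreover have "of_nat CARD('a) = (0 :: 'a)"
    using CHAR_dvd_CARD of_nat_eq_0_iff_char_dvd by blast
  ultimately show False by simp
qed

text \<open>
  The mean of the powers \<open>v^j\<close> for \<open>j < M\<close>, where \<open>v = X^r / w\<close>. If \<open>w^M = 1\<close> and
  \<open>M\<close> is invertible in the field, it takes the value \<open>1\<close> at the roots of
  \<open>X^r - w\<close> and \<open>0\<close> at the other roots of \<open>X^(r * M) - 1\<close>.
\<close>
definition factor_idempotent :: "nat \<Rightarrow> nat \<Rightarrow> 'a::field \<Rightarrow> 'a poly" where
  "factor_idempotent r M w = Polynomial.smult (1 / of_nat M)
     (\<Sum>j = 0..M - 1. Polynomial.monom (w powi (- int j)) (r * j))"

text \<open>
  Up to a unit \<open>f\<close> is \<open>v - 1\<close> for \<open>v = X^r / w\<close>. The geometric sum turns the product with \<open>f\<close> into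
  \<open>v^M - 1\<close>; and modulo \<open>v - 1\<close> each of the \<open>M\<close> terms of the mean is \<open>1\<close>.
\<close>
lemma factor_idempotent_dvd:
  fixes w :: "'a::field" and r M :: nat
  assumes w: "w ^ M = 1" and M: "of_nat M \<noteq> (0 :: 'a)"
  defines "f \<equiv> Polynomial.monom 1 r - [:w:]"
  shows "f dvd Polynomial.monom 1 (r * M) - 1"
    and "Polynomial.monom 1 (r * M) - 1 dvd factor_idempotent r M w * f"
    and "f dvd factor_idempotent r M w - 1"
proof -
  have M0: "0 < M" using M by (cases M) auto
  then have w0: "w \<noteq> 0" using w by (auto simp: power_0_left)
  define v where "v = Polynomial.monom (1 / w) r"
  have f: "f = Polynomial.smult w (v - 1)"
    using w0 by (simp add: f_def v_def smult_diff_right smult_monom one_pCons)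
  then have v1: "f dvd v - 1" using w0 by (simp add: smult_dvd_iff)
  have "Polynomial.monom (w powi (- int j)) (r * j) = v ^ j" for j
    by (simp add: v_def monom_power power_int_minus power_inverse divide_inverse)
  moreover have "{0..M - 1} = {..<M}" using M0 by auto
  ultimately have e: "factor_idempotent r M w = Polynomial.smult (1 / of_nat M) (\<Sum>j<M. v ^ j)"
    by (simp add: factor_idempotent_def)
  have "v ^ M = Polynomial.monom 1 (r * M)" by (simp add: v_def monom_power power_one_over w)
  then have P: "Polynomial.monom 1 (r * M) - 1 = (v - 1) * (\<Sum>j<M. v ^ j)"
    by (metis power_diff_1_eq)
  show "f dvd Polynomial.monom 1 (r * M) - 1" unfolding P using v1 by simp
  have "factor_idempotent r M w * f =
      Polynomial.smult (w / of_nat M) (Polynomial.monom 1 (r * M) - 1)"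
    unfolding e f P by (simp add: mult.commute)
  then show "Polynomial.monom 1 (r * M) - 1 dvd factor_idempotent r M w * f"
    by (simp add: dvd_smult)
  have "(\<Sum>j<M. v ^ j) - of_nat M = (\<Sum>j<M. v ^ j - 1)" by (simp add: sum_subtractf)
  moreover have "f dvd v ^ j - 1" for j
    using v1 by (metis dvd_mult2 power_diff_1_eq)
  ultimately have "f dvd (\<Sum>j<M. v ^ j) - of_nat M" by (simp add: dvd_sum)
  then have "f dvd Polynomial.smult (1 / of_nat M) ((\<Sum>j<M. v ^ j) - of_nat M)" by (rule dvd_smult)
  also have "\<dots> = factor_idempotent r M w - 1"
    using M by (simp add: e smult_diff_right of_nat_poly one_pCons)
  finally show "f dvd factor_idempotent r M w - 1" .
qed

lemma powi_minus_mult: "z powi (- int (i * j)) = (z ^ i) powi (- int j)" for z :: "'a::field"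
  by (simp only: power_int_minus power_int_of_nat power_mult)

lemma idem_poly1_eq: "idem_poly1 p k z j = factor_idempotent 1 (p ^ k) (z ^ j)"
  by (simp add: idem_poly1_def factor_idempotent_def powi_minus_mult del: of_nat_mult)

lemma idem_poly2_eq:
  assumes "s \<le> k"
  shows "idem_poly2 p k m z s l = factor_idempotent (p ^ (s - m)) (p ^ (k + m - s)) (z ^ l)"
proof -
  have "k - s + m = k + m - s" using assms by simp
  then show ?thesis
    by (simp add: idem_poly2_def factor_idempotent_def powi_minus_mult del: of_nat_mult)
qed

section \<open>The primitive idempotents for a prime power exponent\<close>

theorem theorem4p1:
  fixes q p k m :: nat and \<zeta> :: "'a::{field,finite}"
  assumes "CARD('a) = q"
    and "Factorial_Ring.prime p"
    and "k \<ge> 1"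
    and "m \<ge> 1"
    and "exactly_divides p m (gcd (p ^ k) (q - 1))"
    and "primitive_root_of_unity (p ^ m) \<zeta>"
    and "q mod 4 = 1 \<or> odd p"
  shows "{e. primitive_idempotent (cyclic_quotient (p ^ k) :: 'a poly set ring) e} =
      {cyclic_class (p ^ k) (idem_poly1 p k \<zeta> j) | j. 0 \<le> j \<and> j \<le> p ^ m - 1} \<union>
      {cyclic_class (p ^ k) (idem_poly2 p k m \<zeta> s l) | s l.
         m < s \<and> s \<le> k \<and> 0 < l \<and> l < p ^ m \<and> gcd l p = 1}"
proof -
  note q = assms(1) and p = assms(2) and m = assms(4) and \<zeta> = assms(6)
  let ?P = "Polynomial.monom 1 (p ^ k) - 1 :: 'a poly"
  have p1: "1 < p" using p by (rule prime_gt_1_nat)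
  have pm: "0 < p ^ m" using p1 by simp
  have mk: "m \<le> k"
    using assms(5) p1 by (auto simp: exactly_divides_def power_dvd_imp_le)
  have q1: "p ^ m dvd q - 1" using assms(5) by (simp add: exactly_divides_def)
  have q2: "\<not> p ^ Suc m dvd q - 1" if "m < k"
  proof -
    have "p ^ Suc m dvd p ^ k" using that by (intro le_imp_power_dvd) simp
    then show ?thesis using assms(5) by (auto simp: exactly_divides_def)
  qed
  have "p dvd q - 1" using q1 m by (metis dvd_trans dvd_power less_le_trans zero_less_one)
  then have M0: "of_nat (p ^ i) \<noteq> (0 :: 'a)" for i
    using of_nat_neq_0_if_dvd_card_diff_1[of p, where 'a = 'a] q p1 by simp
  have \<zeta>1: "\<zeta> ^ p ^ m = 1" using \<zeta> by (simp add: primitive_root_of_unity_def)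
  have root: "(\<zeta> ^ l) ^ p ^ i = 1" if "m \<le> i" for l i
  proof -
    have "p ^ m dvd l * p ^ i" using that by (simp add: le_imp_power_dvd)
    then show ?thesis using primitive_root_power_eq_1_iff[OF \<zeta>] by (simp flip: power_mult)
  qed
  \<comment> \<open>each proposed idempotent is paired with the factor it belongs to\<close>
  define f where "f = (\<lambda>r l. Polynomial.monom 1 r - [:\<zeta> ^ l:])"
  define I1 where "I1 = {(f 1 j, idem_poly1 p k \<zeta> j) | j. 0 \<le> j \<and> j \<le> p ^ m - 1}"
  define I2 where "I2 = {(f (p ^ (s - m)) l, idem_poly2 p k m \<zeta> s l) | s l.
     m < s \<and> s \<le> k \<and> 0 < l \<and> l < p ^ m \<and> gcd l p = 1}"
  have prime1: "prime_elem (f 1 l)" for l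
  proof -
    have "f 1 l = [:- (\<zeta> ^ l), 1:]" by (simp add: f_def monom_altdef)
    then show ?thesis by (simp add: prime_elem_linear_field_poly)
  qed
  have prime2: "prime_elem (f (p ^ t) l)" if "m < k" "gcd l p = 1" for t l
  proof -
    \<comment> \<open>\<open>\<zeta>^l\<close> has order exactly \<open>p^m\<close>\<close>
    have "\<not> p ^ m dvd l * p ^ (m - 1)"
    proof
      assume "p ^ m dvd l * p ^ (m - 1)"
      then have "p dvd l" using m p1 by (cases m) auto
      then show False using that(2) p1 by (simp add: gcd_nat.absorb2)
    qed
    then have "(\<zeta> ^ l) ^ p ^ (m - 1) \<noteq> 1"
      using primitive_root_power_eq_1_iff[OF \<zeta>] by (simp flip: power_mult)
    \<comment> \<open>the hypothesis on \<open>q\<close> for \<open>p = 2\<close> in the form required by lifting the exponent\<close>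
    moreover have "odd p \<or> 4 dvd q - 1" using assms(7) by presburger
    ultimately show ?thesis
      using q1 q2[OF that(1)] q root[of m l] unfolding f_def
      by (intro field_poly_irreducible_imp_prime irreducible_monom_diff_const[OF p m]) auto
  qed
  have "{e. primitive_idempotent (cyclic_quotient (p ^ k)) e} = cyclic_class (p ^ k) ` snd ` (I1 \<union> I2)"
  proof (rule primitive_idempotents_eq)
    fix h e assume "(h, e) \<in> I1 \<union> I2"
    then obtain t i l where h: "h = f (p ^ t) l"
      and e: "e = factor_idempotent (p ^ t) (p ^ i) (\<zeta> ^ l)"
      and ti: "t + i = k" and i: "m \<le> i" and prime: "prime_elem h"
    proof
      assume "(h, e) \<in> I1"
      then obtain j where j: "h = f 1 j" "e = idem_poly1 p k \<zeta> j" by (auto simp: I1_def)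
      show ?thesis using that[of 0 j k] mk prime1 j by (simp add: idem_poly1_eq)
    next
      assume "(h, e) \<in> I2"
      then obtain s l where "h = f (p ^ (s - m)) l" "e = idem_poly2 p k m \<zeta> s l" "m < s" "s \<le> k" "gcd l p = 1"
        by (auto simp: I2_def)
      then show ?thesis using that[of "s - m" l "k + m - s"] prime2 by (simp add: idem_poly2_eq)
    qed
    have "p ^ k = p ^ t * p ^ i" by (simp flip: ti power_add)
    then show "prime_elem h \<and> h dvd ?P \<and> ?P dvd e * h \<and> h dvd e - 1"
      using factor_idempotent_dvd[OF root[OF i, of l] M0[of i], of "p ^ t"] prime
      unfolding h e f_def by metis
  next
    fix g assume g: "\<And>h e. (h, e) \<in> I1 \<union> I2 \<Longrightarrow> h dvd g"
    \<comment> \<open>the factors with \<open>t = s - m\<close> range over \<open>1 \<le> t \<le> k - m\<close>\<close>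
    have "\<exists>N. Polynomial.monom 1 (p ^ (m + (k - m))) - 1 dvd g ^ N"
    proof (rule monom_diff_1_dvd_power[OF \<zeta> p m])
      fix j assume "j < p ^ m"
      then have "(f 1 j, idem_poly1 p k \<zeta> j) \<in> I1" by (auto simp: I1_def)
      then show "Polynomial.monom 1 1 - [:\<zeta> ^ j:] dvd g" using g by (auto simp: f_def)
    next
      fix t l assume "1 \<le> t" "t \<le> k - m" "l < p ^ m" "\<not> p dvd l"
      moreover from this have "0 < l" by (cases l) auto
      moreover have "gcd l p = 1"
        using p \<open>\<not> p dvd l\<close> prime_imp_coprime[of p l] by (simp add: gcd.commute coprime_iff_gcd_eq_1)
      ultimately have "(f (p ^ (t + m - m)) l, idem_poly2 p k m \<zeta> (t + m) l) \<in> I2"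
        unfolding I2_def
        by (intro CollectI exI[of _ "t + m"] exI[of _ l] conjI refl) simp_all
      then show "Polynomial.monom 1 (p ^ t) - [:\<zeta> ^ l:] dvd g" using g by (auto simp: f_def)
    qed
    then show "\<exists>N. ?P dvd g ^ N" using mk by simp
  qed
  also have "\<dots> = {cyclic_class (p ^ k) (idem_poly1 p k \<zeta> j) | j. 0 \<le> j \<and> j \<le> p ^ m - 1} \<union>
      {cyclic_class (p ^ k) (idem_poly2 p k m \<zeta> s l) | s l.
         m < s \<and> s \<le> k \<and> 0 < l \<and> l < p ^ m \<and> gcd l p = 1}"
  proof -
    have "c ` snd ` {(a j, b j) | j. Q j} = {c (b j) | j. Q j}"
      for a :: "nat \<Rightarrow> 'a poly" and b :: "nat \<Rightarrow> 'a poly" and c :: "'a poly \<Rightarrow> 'a poly set" and Q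
      by force
    moreover have "c ` snd ` {(a s l, b s l) | s l. Q s l} = {c (b s l) | s l. Q s l}"
      for a :: "nat \<Rightarrow> nat \<Rightarrow> 'a poly" and b :: "nat \<Rightarrow> nat \<Rightarrow> 'a poly"
        and c :: "'a poly \<Rightarrow> 'a poly set" and Q
      by force
    ultimately show ?thesis unfolding image_Un I1_def I2_def by (simp only:)
  qed
  finally show ?thesis .
qed

end
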